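(* For every integer $n\geq 1$, $op_{2,1}(n,1)=\overline{p}(n)/2$.
   Context: An overpartition of $n$ is a partition of $n$ (a finite non-increasing sequence of positive integers summing to $n$) in which the last occurrence of each part size may be overlined. $\overline{p}(n)$ denotes the number of overpartitions of $n$. For an overpartition $\pi$, $\overline{mex}_{2,1}(\pi)$ denotes the smallest positive odd integer that does not occur as a non-overlined part of $\pi$. For $n\geq 1$ and $k\geq 0$, $op_{2,1}(n,k)$ denotes the number of overpartitions $\pi$ of $n$ such that $\overline{mex}_{2,1}(\pi)\geq 2k+1$ and $\overline{mex}_{2,1}(\pi)\equiv 2k+1 \pmod 4$. *)

theory Defs
  imports Complex_Main "HOL-Number_Theory.Cong"
begin

text \<open>An entry \<open>(m, b)\<close> is a part of size \<open>m\<close>, overlined iff \<open>b\<close>. The last conjunct says that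
  an overlined entry is the last occurrence of its part size.\<close>

definition overpartition :: "nat \<Rightarrow> (nat \<times> bool) list \<Rightarrow> bool" where
  "overpartition n \<pi> \<longleftrightarrow>
     sorted_wrt (\<ge>) (map fst \<pi>) \<and>
     (\<forall>m \<in> set (map fst \<pi>). m > 0) \<and>
     sum_list (map fst \<pi>) = n \<and>
     (\<forall>i j. i < j \<and> j < length \<pi> \<and> fst (\<pi> ! i) = fst (\<pi> ! j) \<longrightarrow> \<not> snd (\<pi> ! i))"

definition overpartition_count :: "nat \<Rightarrow> nat" where
  "overpartition_count n = card {\<pi>. overpartition n \<pi>}"

definition overline_mex_2_1 :: "(nat \<times> bool) list \<Rightarrow> nat" where
  "overline_mex_2_1 \<pi> = (LEAST m. m > 0 \<and> odd m \<and> (m, False) \<notin> set \<pi>)"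

definition op_2_1 :: "nat \<Rightarrow> nat \<Rightarrow> nat" where
  "op_2_1 n k = card {\<pi>. overpartition n \<pi> \<and>
     overline_mex_2_1 \<pi> \<ge> 2 * k + 1 \<and> [overline_mex_2_1 \<pi> = 2 * k + 1] (mod 4)}"

text \<open>The sets counted above are finite, so \<open>card\<close> is a genuine count.\<close>

lemma finite_overpartitions: "finite {\<pi>. overpartition n \<pi>}"
proof (rule finite_subset)
  show "{\<pi>. overpartition n \<pi>} \<subseteq> {xs. set xs \<subseteq> {..n} \<times> UNIV \<and> length xs \<le> n}"
  proof safe
    fix \<pi> a b assume p: "overpartition n \<pi>"
    { assume "(a, b) \<in> set \<pi>"
      then have "a \<in> set (map fst \<pi>)" by force
      then have "a \<le> sum_list (map fst \<pi>)" by (intro member_le_sum_list) auto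
      then show "a \<le> n" using p by (simp add: overpartition_def) }
    have "length xs \<le> sum_list xs" if "\<forall>m \<in> set xs. m > 0" for xs :: "nat list"
      using that by (induction xs) auto
    from this[of "map fst \<pi>"] show "length \<pi> \<le> n"
      using p by (auto simp: overpartition_def)
  qed simp
  show "finite {xs :: (nat \<times> bool) list. set xs \<subseteq> {..n} \<times> UNIV \<and> length xs \<le> n}"
    by (rule finite_lists_length_le) simp
qed

end

theory Submission
  imports Defs "HOL-Computational_Algebra.Formal_Power_Series"
begin

text \<open>
  An overpartition contains the non-overlined parts \<open>1, 3, \<dots>, 2 j - 1\<close> iff it arises from an
  overpartition of \<open>n - j\<^sup>2\<close> by adding them, and its mex is \<open>2 j + 1\<close> for the largest such \<open>j\<close>.
  Since \<open>\<Sum>i=1..j. (-1) ^ (i - 1)\<close> is \<open>1\<close> for odd \<open>j\<close> and \<open>0\<close> for even \<open>j\<close>, the number of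
  overpartitions with mex \<open>3\<close> modulo \<open>4\<close> is the alternating sum over \<open>j \<ge> 1\<close> of the number of
  overpartitions of \<open>n - j\<^sup>2\<close>. Gauss's identity, which says that \<open>\<Sum>j\<in>\<int>. (-1) ^ j * q ^ j\<^sup>2\<close> is
  inverse to the generating function of overpartitions, equates this with half the number of
  overpartitions of \<open>n\<close>. Gauss's identity follows from a finite form in the style of Shanks: with
  \<open>P\<^sub>N\<close> generating the overpartitions with parts at most \<open>N\<close>,
  \<open>P\<^sub>N * (\<Sum>j=-N..N. (-1) ^ j * q ^ j\<^sup>2) = (\<Sum>s\<le>N. 2 * (-q) ^ s * P\<^sub>s / (1 + q ^ s) * q ^ (s * N))\<close>,
  and the right-hand side is \<open>1\<close> up to terms of order greater than \<open>N\<close>.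
\<close>

section \<open>Overpartitions as sorted lists\<close>

text \<open>Merges the order of sizes and the rule on overlines into one relation between an earlier
  and a later entry; the resulting \<open>sorted_wrt\<close> condition splits along Cons and
  append.\<close>

definition may_precede :: "nat \<times> bool \<Rightarrow> nat \<times> bool \<Rightarrow> bool" where
  "may_precede p q \<longleftrightarrow> fst q \<le> fst p \<and> (fst p = fst q \<longrightarrow> \<not> snd p)"

lemma overpartition_iff:
  "overpartition n \<pi> \<longleftrightarrow>
     sorted_wrt may_precede \<pi> \<and> (\<forall>p\<in>set \<pi>. 0 < fst p) \<and> sum_list (map fst \<pi>) = n"
  unfolding overpartition_def may_precede_def sorted_wrt_map
  by (auto simp: sorted_wrt_iff_nth_less)

lemma overpartition_part_le:
  assumes "overpartition n \<pi>" "p \<in> set \<pi>"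
  shows "fst p \<le> n"
proof -
  have "fst p \<le> sum_list (map fst \<pi>)"
    using assms(2) by (intro member_le_sum_list) auto
  then show ?thesis
    using assms(1) by (simp add: overpartition_iff)
qed

section \<open>Overpartitions with bounded parts\<close>

definition bounded_overpartitions :: "nat \<Rightarrow> nat \<Rightarrow> (nat \<times> bool) list set" where
  "bounded_overpartitions N n = {\<pi>. overpartition n \<pi> \<and> (\<forall>p\<in>set \<pi>. fst p \<le> N)}"

lemma finite_bounded_overpartitions [simp]: "finite (bounded_overpartitions N n)"
  using finite_overpartitions[of n] by (simp add: bounded_overpartitions_def)

lemma card_bounded_overpartitions_self:
  "n \<le> N \<Longrightarrow> card (bounded_overpartitions N n) = overpartition_count n"
  unfolding bounded_overpartitions_def overpartition_count_def
  by (metis (no_types, lifting) overpartition_part_le order_trans)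

lemma bounded_overpartitions_0:
  "bounded_overpartitions 0 n = (if n = 0 then {[]} else {})"
proof -
  have "\<pi> \<in> bounded_overpartitions 0 n \<longleftrightarrow> \<pi> = [] \<and> n = 0" for \<pi>
    by (cases \<pi>) (auto simp: bounded_overpartitions_def overpartition_iff)
  then show ?thesis by auto
qed

lemma bounded_overpartitions_Suc_less:
  assumes "n < Suc N"
  shows "bounded_overpartitions (Suc N) n = bounded_overpartitions N n"
  using assms overpartition_part_le[of n] unfolding bounded_overpartitions_def by fastforce

text \<open>Look at the first entry. An overlined \<open>Suc N\<close> is the last part of that
  size, so the tail has parts at most \<open>N\<close>; a non-overlined one may be followed by more
  copies.\<close>

lemma bounded_overpartitions_Suc:
  assumes "Suc N \<le> n"
  shows "bounded_overpartitions (Suc N) n =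
    bounded_overpartitions N n \<union>
    (Cons (Suc N, True) ` bounded_overpartitions N (n - Suc N) \<union>
     Cons (Suc N, False) ` bounded_overpartitions (Suc N) (n - Suc N))"
    (is "?L = ?A \<union> (?B \<union> ?C)")
proof (intro equalityI subsetI)
  fix \<pi> assume \<pi>: "\<pi> \<in> ?L"
  show "\<pi> \<in> ?A \<union> (?B \<union> ?C)"
  proof (cases \<pi>)
    case Nil
    then show ?thesis using \<pi> by (auto simp: bounded_overpartitions_def)
  next
    case (Cons p \<rho>)
    obtain m b where p: "p = (m, b)" by (cases p)
    have m: "m \<le> Suc N" and "m > 0" and s: "m + sum_list (map fst \<rho>) = n"
      and sorted: "sorted_wrt may_precede \<rho>" and first: "\<forall>q\<in>set \<rho>. may_precede p q"
      and pos: "\<forall>q\<in>set \<rho>. 0 < fst q"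
      using \<pi> by (auto simp: Cons p bounded_overpartitions_def overpartition_iff)
    have le: "\<forall>q\<in>set \<rho>. fst q \<le> m"
      using first by (auto simp: may_precede_def p)
    consider "m \<le> N" | "m = Suc N" b | "m = Suc N" "\<not> b" using m by linarith
    then show ?thesis
    proof cases
      case 1
      then have "\<pi> \<in> ?A"
        using \<pi> le by (auto simp: bounded_overpartitions_def Cons p)
      then show ?thesis by simp
    next
      case 2
      then have "\<forall>q\<in>set \<rho>. fst q \<le> N"
        using first by (auto simp: may_precede_def p le_Suc_eq)
      then have "\<rho> \<in> bounded_overpartitions N (n - Suc N)"
        using s sorted pos 2 by (auto simp: bounded_overpartitions_def overpartition_iff)
      then show ?thesis using 2 by (simp add: Cons p)
    next
      case 3
      then have "\<rho> \<in> bounded_overpartitions (Suc N) (n - Suc N)"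
        using s sorted pos le by (auto simp: bounded_overpartitions_def overpartition_iff)
      then show ?thesis using 3 by (simp add: Cons p)
    qed
  qed
next
  fix \<pi> assume "\<pi> \<in> ?A \<union> (?B \<union> ?C)"
  then show "\<pi> \<in> ?L"
    using assms
    by (fastforce simp: bounded_overpartitions_def overpartition_iff may_precede_def)
qed

lemma card_bounded_overpartitions_Suc:
  assumes "Suc N \<le> n"
  shows "card (bounded_overpartitions (Suc N) n) =
    card (bounded_overpartitions N n) + card (bounded_overpartitions N (n - Suc N)) +
    card (bounded_overpartitions (Suc N) (n - Suc N))"
proof -
  let ?B = "Cons (Suc N, True) ` bounded_overpartitions N (n - Suc N)"
  let ?C = "Cons (Suc N, False) ` bounded_overpartitions (Suc N) (n - Suc N)"
  have "bounded_overpartitions N n \<inter> (?B \<union> ?C) = {}"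
    by (auto simp: bounded_overpartitions_def)
  moreover have "?B \<inter> ?C = {}"
    by auto
  ultimately show ?thesis
    by (simp add: bounded_overpartitions_Suc[OF assms] card_Un_disjoint card_image)
qed

section \<open>Gauss's identity\<close>

unbundle fps_syntax

definition overpartition_fps :: "nat \<Rightarrow> real fps" where
  "overpartition_fps N = Abs_fps (\<lambda>n. real (card (bounded_overpartitions N n)))"

lemma overpartition_fps_0: "overpartition_fps 0 = 1"
  by (rule fps_ext) (simp add: overpartition_fps_def bounded_overpartitions_0)

text \<open>The recursion above in generating function form: part size \<open>Suc N\<close>
  contributes the factor (1 + q^(N+1)) / (1 - q^(N+1)).\<close>

lemma overpartition_fps_Suc:
  "overpartition_fps (Suc N) * (1 - fps_X ^ Suc N) = overpartition_fps N * (1 + fps_X ^ Suc N)"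
proof (rule fps_ext)
  fix n
  show "(overpartition_fps (Suc N) * (1 - fps_X ^ Suc N)) $ n =
    (overpartition_fps N * (1 + fps_X ^ Suc N)) $ n"
    using card_bounded_overpartitions_Suc[of N n] bounded_overpartitions_Suc_less[of n N]
    by (simp add: overpartition_fps_def distrib_left right_diff_distrib
        fps_X_power_mult_right_nth del: power_Suc)
qed

definition gauss_coeff :: "nat \<Rightarrow> real fps" where
  "gauss_coeff s = 2 * (- fps_X) ^ s * overpartition_fps s * inverse (1 + fps_X ^ s)"

lemma gauss_coeff_mult: "(1 + fps_X ^ s) * gauss_coeff s = 2 * (- fps_X) ^ s * overpartition_fps s"
proof -
  have "(1 + fps_X ^ s :: real fps) $ 0 \<noteq> 0"
    by (cases s) auto
  then have "(1 + fps_X ^ s :: real fps) * inverse (1 + fps_X ^ s) = 1"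
    by (simp add: inverse_mult_eq_1')
  moreover have "(1 + fps_X ^ s) * gauss_coeff s =
      2 * (- fps_X) ^ s * overpartition_fps s * ((1 + fps_X ^ s) * inverse (1 + fps_X ^ s))"
    unfolding gauss_coeff_def by (simp only: mult_ac)
  ultimately show ?thesis
    by simp
qed

lemma gauss_coeff_0: "gauss_coeff 0 = 1"
  using gauss_coeff_mult[of 0] by (simp add: overpartition_fps_0)

text \<open>The factor 1 + q^(s+1) gained by the overpartition series cancels the new denominator,
  and the old denominator 1 + q^s reappears as a numerator. This ratio drives the telescoping
  below.\<close>

lemma gauss_coeff_Suc:
  "(1 - fps_X ^ Suc s) * gauss_coeff (Suc s) = - fps_X * (1 + fps_X ^ s) * gauss_coeff s"
proof -
  have "(1 + fps_X ^ Suc s) * ((1 - fps_X ^ Suc s) * gauss_coeff (Suc s)) =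
      2 * (- fps_X) ^ Suc s * (overpartition_fps (Suc s) * (1 - fps_X ^ Suc s))"
    unfolding mult.left_commute[of "1 + fps_X ^ Suc s"] gauss_coeff_mult by (simp only: mult_ac)
  also have "\<dots> = (1 + fps_X ^ Suc s) * (- fps_X * (2 * (- fps_X) ^ s * overpartition_fps s))"
    unfolding overpartition_fps_Suc power_Suc[of "- fps_X"] by (simp only: mult_ac)
  also have "\<dots> = (1 + fps_X ^ Suc s) * (- fps_X * ((1 + fps_X ^ s) * gauss_coeff s))"
    by (simp only: gauss_coeff_mult)
  finally have *: "(1 + fps_X ^ Suc s) * ((1 - fps_X ^ Suc s) * gauss_coeff (Suc s)) = \<dots>" .
  have "(1 + fps_X ^ Suc s :: real fps) $ 0 \<noteq> 0"
    by simp
  then have "(1 + fps_X ^ Suc s :: real fps) \<noteq> 0"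
    by (metis fps_zero_nth)
  from mult_left_cancel[OF this] * show ?thesis
    by (simp only: mult.assoc)
qed

text \<open>With S_N the right-hand side of the finite identity, the summands are the termwise
  differences of S_(k+1) (1 - q^(k+1)) and S_k (1 + q^(k+1)). By \<open>gauss_coeff_Suc\<close> each
  is the increment of the closed form.\<close>

lemma gauss_telescope:
  "(\<Sum>s\<le>m. gauss_coeff s *
      (fps_X ^ (s * Suc k) * (1 - fps_X ^ Suc k) - fps_X ^ (s * k) * (1 + fps_X ^ Suc k))) =
    - (fps_X ^ (m * k + Suc k) * (1 + fps_X ^ m) * gauss_coeff m)"
proof (induction m)
  case 0
  show ?case by (simp add: gauss_coeff_0)
next
  case (Suc m)
  let ?X = "fps_X :: real fps"
  have "?X ^ (m * k + Suc k) * (1 + ?X ^ m) * gauss_coeff m =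
      - (?X ^ (Suc m * k) * (- ?X * (1 + ?X ^ m) * gauss_coeff m))"
    by (simp add: power_add algebra_simps)
  also have "\<dots> = - (?X ^ (Suc m * k) * ((1 - ?X ^ Suc m) * gauss_coeff (Suc m)))"
    by (simp only: gauss_coeff_Suc)
  finally show ?case
    unfolding sum.atMost_Suc Suc by (simp add: power_add algebra_simps)
qed

text \<open>Both sides F_N satisfy F_(N+1) (1 - q^(N+1)) - F_N (1 + q^(N+1)) = 2 (-1)^(N+1)
  q^((N+1)^2) P_(N+1) (1 - q^(N+1)), where P_N is \<open>overpartition_fps N\<close>.\<close>

lemma finite_gauss_identity:
  "(1 + 2 * (\<Sum>j=1..N. (-1) ^ j * fps_X ^ j\<^sup>2)) * overpartition_fps N =
    (\<Sum>s\<le>N. gauss_coeff s * fps_X ^ (s * N))"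
proof (induction N)
  case 0
  show ?case by (simp add: overpartition_fps_0 gauss_coeff_0)
next
  case (Suc k)
  let ?X = "fps_X :: real fps"
  let ?N = "Suc k"
  let ?\<theta> = "\<lambda>N. 1 + 2 * (\<Sum>j=1..N. (-1) ^ j * ?X ^ j\<^sup>2)"
  let ?S = "\<lambda>N. \<Sum>s\<le>N. gauss_coeff s * ?X ^ (s * N)"
  \<comment> \<open>\<open>?S k\<close> stops at \<open>s = k\<close>; the sum is extended to
    \<open>s = ?N\<close> so that it telescopes, and the last summand compensates.\<close>
  have "?S ?N * (1 - ?X ^ ?N) - ?S k * (1 + ?X ^ ?N) =
      (\<Sum>s\<le>?N. gauss_coeff s * (?X ^ (s * ?N) * (1 - ?X ^ ?N) - ?X ^ (s * k) * (1 + ?X ^ ?N)))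
      + gauss_coeff ?N * ?X ^ (?N * k) * (1 + ?X ^ ?N)"
    by (simp add: sum_distrib_right sum_subtractf right_diff_distrib mult.assoc distrib_right
        del: power_Suc mult_Suc mult_Suc_right)
  also have "\<dots> = ?X ^ (?N * k) * (1 - ?X ^ ?N) * ((1 + ?X ^ ?N) * gauss_coeff ?N)"
    unfolding gauss_telescope by (simp add: power_add algebra_simps)
  also have "\<dots> = 2 * ((-1) ^ ?N * ?X ^ ?N\<^sup>2) * (overpartition_fps ?N * (1 - ?X ^ ?N))"
  proof -
    have "?X ^ ?N\<^sup>2 = ?X ^ (?N * k) * ?X ^ ?N"
      unfolding power_add[symmetric] by (simp add: power2_eq_square)
    moreover have "(- ?X) ^ ?N = (-1) ^ ?N * ?X ^ ?N"
      by (rule power_minus)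
    ultimately show ?thesis
      unfolding gauss_coeff_mult by (simp only: mult_ac)
  qed
  finally have "?S ?N * (1 - ?X ^ ?N) =
      ?S k * (1 + ?X ^ ?N) + 2 * ((-1) ^ ?N * ?X ^ ?N\<^sup>2) * (overpartition_fps ?N * (1 - ?X ^ ?N))"
    by (simp only: diff_eq_eq add.commute)
  also have "?S k * (1 + ?X ^ ?N) = ?\<theta> k * (overpartition_fps ?N * (1 - ?X ^ ?N))"
    unfolding Suc[symmetric] overpartition_fps_Suc by (simp only: mult_ac)
  also have "\<dots> + 2 * ((-1) ^ ?N * ?X ^ ?N\<^sup>2) * (overpartition_fps ?N * (1 - ?X ^ ?N)) =
      ?\<theta> ?N * overpartition_fps ?N * (1 - ?X ^ ?N)"
    by (simp add: distrib_left distrib_right mult.assoc del: power_Suc)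
  finally have *: "?S ?N * (1 - ?X ^ ?N) = \<dots>" .
  have "(1 - ?X ^ ?N) $ 0 \<noteq> 0"
    by simp
  then have "1 - ?X ^ ?N \<noteq> 0"
    by (metis fps_zero_nth)
  from mult_right_cancel[OF this, THEN iffD1, OF *] show ?case
    by (rule sym)
qed

text \<open>Compare coefficients of q^n in the finite identity for \<open>N = n\<close>, where
  truncating both the theta sum and the part sizes at \<open>n\<close> loses nothing.\<close>

lemma gauss_recurrence:
  assumes "n \<ge> 1"
  shows "real (overpartition_count n) +
    2 * (\<Sum>j=1..n. (-1) ^ j * (if j\<^sup>2 \<le> n then real (overpartition_count (n - j\<^sup>2)) else 0)) = 0"
proof -
  let ?P = "overpartition_fps n"
  have "(gauss_coeff s * fps_X ^ (s * n)) $ n = 0" for s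
  proof (cases "s = 0")
    case True
    then show ?thesis using assms by (simp add: gauss_coeff_0)
  next
    case False
    \<comment> \<open>The factor \<open>(- fps_X) ^ s\<close> inside \<open>gauss_coeff s\<close>
      lifts the order from \<open>s * n\<close> to \<open>s + s * n\<close>, past
      \<open>n\<close>.\<close>
    have "gauss_coeff s * fps_X ^ (s * n) =
        fps_X ^ (s + s * n) * ((-1) ^ s * 2 * overpartition_fps s * inverse (1 + fps_X ^ s))"
      by (simp add: gauss_coeff_def power_minus[of fps_X] power_add mult_ac)
    moreover have "n < s + s * n"
      using False by (cases s) auto
    ultimately show ?thesis
      by (simp add: fps_X_power_mult_nth)
  qed
  then have "((1 + 2 * (\<Sum>j=1..n. (-1) ^ j * fps_X ^ j\<^sup>2)) * ?P) $ n = 0"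
    unfolding finite_gauss_identity by (simp add: fps_sum_nth)
  moreover have "(1 + 2 * (\<Sum>j=1..n. (-1) ^ j * fps_X ^ j\<^sup>2)) * ?P =
      ?P + fps_const 2 * (\<Sum>j=1..n. fps_const ((-1) ^ j) * (fps_X ^ j\<^sup>2 * ?P))"
    by (simp add: distrib_right sum_distrib_right mult.assoc
        flip: fps_const_power fps_const_neg fps_numeral_fps_const)
  ultimately have "?P $ n + 2 * (\<Sum>j=1..n. (-1) ^ j * (fps_X ^ j\<^sup>2 * ?P) $ n) = 0"
    by (simp add: fps_sum_nth)
  moreover have "(fps_X ^ j\<^sup>2 * ?P) $ n =
      (if j\<^sup>2 \<le> n then real (overpartition_count (n - j\<^sup>2)) else 0)" for j
    by (simp add: fps_X_power_mult_nth overpartition_fps_def card_bounded_overpartitions_self)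
  ultimately show ?thesis
    by (simp add: overpartition_fps_def card_bounded_overpartitions_self)
qed

section \<open>Overpartitions with prescribed non-overlined parts\<close>

text \<open>The new part goes before all entries of size \<open>m\<close>, so an overlined
  \<open>m\<close> stays last among them and \<open>remove1\<close> undoes the insertion.\<close>

definition insert_part :: "nat \<Rightarrow> (nat \<times> bool) list \<Rightarrow> (nat \<times> bool) list" where
  "insert_part m \<pi> =
    takeWhile (\<lambda>p. m < fst p) \<pi> @ (m, False) # dropWhile (\<lambda>p. m < fst p) \<pi>"

lemma set_insert_part: "set (insert_part m \<pi>) = insert (m, False) (set \<pi>)"
  unfolding insert_part_def
  by (metis Un_insert_right list.set(2) set_append takeWhile_dropWhile_id)

lemma remove1_insert_part: "remove1 (m, False) (insert_part m \<pi>) = \<pi>"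
proof -
  have "(m, False) \<notin> set (takeWhile (\<lambda>p. m < fst p) \<pi>)"
    using set_takeWhileD by fastforce
  then show ?thesis
    by (simp add: insert_part_def remove1_append)
qed

lemma overpartition_insert_part:
  assumes "overpartition n \<pi>" "m > 0"
  shows "overpartition (n + m) (insert_part m \<pi>)"
proof -
  define xs ys where "xs = takeWhile (\<lambda>p. m < fst p) \<pi>" and "ys = dropWhile (\<lambda>p. m < fst p) \<pi>"
  have \<pi>: "\<pi> = xs @ ys"
    by (simp add: xs_def ys_def)
  have xs: "\<forall>p\<in>set xs. m < fst p"
    using set_takeWhileD unfolding xs_def by fastforce
  have "\<forall>p\<in>set ys. fst p \<le> m"
  proof (cases ys)
    case (Cons q zs)
    then have "\<not> m < fst q"
      unfolding ys_def by (metis dropWhile_eq_Cons_conv)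
    then show ?thesis
      using assms(1) by (fastforce simp: \<pi> Cons overpartition_iff sorted_wrt_append may_precede_def)
  qed simp
  with xs assms have "overpartition (n + m) (xs @ (m, False) # ys)"
    by (fastforce simp: \<pi> overpartition_iff sorted_wrt_append may_precede_def)
  then show ?thesis
    by (simp add: insert_part_def xs_def ys_def)
qed

lemma overpartition_remove1:
  assumes "overpartition n \<pi>" "(m, False) \<in> set \<pi>"
  shows "overpartition (n - m) (remove1 (m, False) \<pi>)"
    and "insert_part m (remove1 (m, False) \<pi>) = \<pi>"
proof -
  obtain xs ys where \<pi>: "\<pi> = xs @ (m, False) # ys" and notin: "(m, False) \<notin> set xs"
    using assms(2) by (meson split_list_first)
  have r: "remove1 (m, False) \<pi> = xs @ ys"
    using notin by (simp add: \<pi> remove1_append)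
  show "overpartition (n - m) (remove1 (m, False) \<pi>)"
    unfolding r using assms(1) by (auto simp: \<pi> overpartition_iff sorted_wrt_append)
  \<comment> \<open>An entry of size \<open>m\<close> before this one could not be overlined, so it
    would be an earlier copy of \<open>(m, False)\<close>.\<close>
  have xs: "\<forall>p\<in>set xs. m < fst p"
  proof
    fix p assume p: "p \<in> set xs"
    then have "may_precede p (m, False)"
      using assms(1) by (auto simp: \<pi> overpartition_iff sorted_wrt_append)
    moreover have "p \<noteq> (m, False)"
      using p notin by auto
    ultimately show "m < fst p"
      by (cases p) (auto simp: may_precede_def)
  qed
  have ys: "\<forall>p\<in>set ys. \<not> m < fst p"
    using assms(1) by (auto simp: \<pi> overpartition_iff sorted_wrt_append may_precede_def not_less)
  have "takeWhile (\<lambda>p. m < fst p) ys = []" "dropWhile (\<lambda>p. m < fst p) ys = ys"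
    using ys by (cases ys; simp)+
  with xs show "insert_part m (remove1 (m, False) \<pi>) = \<pi>"
    unfolding r insert_part_def by (simp add: \<pi> takeWhile_append2 dropWhile_append2)
qed

definition overpartitions_containing :: "nat \<Rightarrow> nat set \<Rightarrow> (nat \<times> bool) list set" where
  "overpartitions_containing n S = {\<pi>. overpartition n \<pi> \<and> (\<forall>m\<in>S. (m, False) \<in> set \<pi>)}"

lemma finite_overpartitions_containing [simp]: "finite (overpartitions_containing n S)"
  using finite_overpartitions[of n] by (simp add: overpartitions_containing_def)

text \<open>Further copies of \<open>m\<close> may remain after one is removed, so the smaller
  overpartitions carry no condition on \<open>m\<close>; as \<open>m\<close> is not in
  \<open>S\<close>, the other required parts survive.\<close>

lemma bij_betw_insert_part:
  assumes "m > 0" "m \<notin> S" "m \<le> n"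
  shows "bij_betw (insert_part m) (overpartitions_containing (n - m) S)
    (overpartitions_containing n (insert m S))"
proof (rule bij_betw_byWitness[where f' = "remove1 (m, False)"])
  show "\<forall>\<pi>\<in>overpartitions_containing (n - m) S. remove1 (m, False) (insert_part m \<pi>) = \<pi>"
    by (simp add: remove1_insert_part)
  show "\<forall>\<pi>\<in>overpartitions_containing n (insert m S).
      insert_part m (remove1 (m, False) \<pi>) = \<pi>"
    by (auto simp: overpartitions_containing_def overpartition_remove1)
  show "insert_part m ` overpartitions_containing (n - m) S \<subseteq>
      overpartitions_containing n (insert m S)"
    using overpartition_insert_part[of "n - m" _ m] assms
    by (auto simp: overpartitions_containing_def set_insert_part)
  show "remove1 (m, False) ` overpartitions_containing n (insert m S) \<subseteq>
      overpartitions_containing (n - m) S"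
  proof clarify
    fix \<pi> assume "\<pi> \<in> overpartitions_containing n (insert m S)"
    moreover have "(k, False) \<in> set (remove1 (m, False) \<pi>) \<longleftrightarrow> (k, False) \<in> set \<pi>"
      if "k \<in> S" for k
      using that assms(2) by (intro in_set_remove1) auto
    ultimately show "remove1 (m, False) \<pi> \<in> overpartitions_containing (n - m) S"
      by (auto simp: overpartitions_containing_def overpartition_remove1)
  qed
qed

lemma card_overpartitions_containing:
  assumes "finite S" "0 \<notin> S"
  shows "card (overpartitions_containing n S) =
    (if \<Sum>S \<le> n then overpartition_count (n - \<Sum>S) else 0)"
  using assms
proof (induction S arbitrary: n)
  case empty
  show ?case by (simp add: overpartitions_containing_def overpartition_count_def)
next
  case (insert m S)
  show ?case
  proof (cases "m \<le> n")
    case True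
    have "card (overpartitions_containing n (insert m S)) =
        card (overpartitions_containing (n - m) S)"
      using bij_betw_same_card[OF bij_betw_insert_part] insert.prems insert.hyps True by force
    then show ?thesis
      using insert True by (simp add: le_diff_conv2 add.commute)
  next
    case False
    then have "overpartitions_containing n (insert m S) = {}"
      by (auto simp: overpartitions_containing_def dest: overpartition_part_le)
    then show ?thesis using False insert.hyps by simp
  qed
qed

section \<open>The minimal excluded odd part\<close>

abbreviation first_odds :: "nat \<Rightarrow> nat set" where
  "first_odds j \<equiv> (\<lambda>i. 2 * i + 1) ` {..<j}"

lemma sum_first_odds: "\<Sum>(first_odds j) = j\<^sup>2"
proof -
  have "\<Sum>(first_odds j) = (\<Sum>i<j. 2 * i + 1)"
    by (subst sum.reindex) (auto simp: inj_on_def)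
  also have "\<dots> = j\<^sup>2"
    by (induction j) (auto simp: power2_eq_square)
  finally show ?thesis .
qed

lemma card_overpartitions_containing_first_odds:
  "card (overpartitions_containing n (first_odds j)) =
    (if j\<^sup>2 \<le> n then overpartition_count (n - j\<^sup>2) else 0)"
proof -
  have "finite (first_odds j)" "0 \<notin> first_odds j"
    by auto
  from card_overpartitions_containing[OF this] show ?thesis
    unfolding sum_first_odds .
qed

lemma overline_mex_conv:
  assumes "overpartition n \<pi>"
  obtains j where "overline_mex_2_1 \<pi> = 2 * j + 1" "j \<le> n"
    "\<And>i. \<pi> \<in> overpartitions_containing n (first_odds i) \<longleftrightarrow> i \<le> j"
proof -
  let ?Q = "\<lambda>i. (2 * i + 1, False) \<notin> set \<pi>"
  define j where "j = (LEAST i. ?Q i)"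
  \<comment> \<open>The part \<open>2 * n + 1\<close> exceeds \<open>n\<close>. This bounds
    \<open>j\<close>, so later sums over \<open>1..n\<close> reach every relevant index.\<close>
  have n: "?Q n"
    using overpartition_part_le[OF assms] by fastforce
  then have j: "?Q j" and "j \<le> n"
    unfolding j_def by (rule LeastI, rule Least_le)
  have below: "(2 * i + 1, False) \<in> set \<pi>" if "i < j" for i
    using not_less_Least[of i ?Q] that unfolding j_def by blast
  have "overline_mex_2_1 \<pi> = 2 * j + 1"
    unfolding overline_mex_2_1_def
  proof (rule Least_equality)
    show "2 * j + 1 > 0 \<and> odd (2 * j + 1) \<and> (2 * j + 1, False) \<notin> set \<pi>"
      using j by simp
  next
    fix m assume m: "m > 0 \<and> odd m \<and> (m, False) \<notin> set \<pi>"
    then obtain i where "m = 2 * i + 1" by (auto elim: oddE)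
    then show "2 * j + 1 \<le> m"
      using m below[of i] by (cases "i < j") auto
  qed
  moreover have "\<pi> \<in> overpartitions_containing n (first_odds i) \<longleftrightarrow> i \<le> j" for i
    using assms j below by (force simp: overpartitions_containing_def not_less)
  ultimately show ?thesis
    using \<open>j \<le> n\<close> that by blast
qed

lemma alternating_sum_atMost:
  "(\<Sum>i=1..j. (-1) ^ i :: 'a :: ring_1) = (if odd j then - 1 else 0)"
  by (induction j) auto

lemma op_2_1_eq_alternating_sum:
  "real (op_2_1 n 1) =
    - (\<Sum>i=1..n. (-1) ^ i * real (card (overpartitions_containing n (first_odds i))))"
proof -
  let ?O = "{\<pi>. overpartition n \<pi>}"
  let ?E = "\<lambda>i. overpartitions_containing n (first_odds i)"
  let ?M = "{\<pi>. overpartition n \<pi> \<and>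
     overline_mex_2_1 \<pi> \<ge> 2 * 1 + 1 \<and> [overline_mex_2_1 \<pi> = 2 * 1 + 1] (mod 4)}"
  \<comment> \<open>The alternating sum is established for each overpartition separately; summing
    over \<open>?O\<close> and swapping the sums turns indicators into cardinalities.\<close>
  have indicator: "(if \<pi> \<in> ?M then 1 else 0) = - (\<Sum>i=1..n. (-1) ^ i * (if \<pi> \<in> ?E i then 1 else 0 :: real))"
    if \<pi>: "\<pi> \<in> ?O" for \<pi>
  proof -
    obtain j where j: "overline_mex_2_1 \<pi> = 2 * j + 1" "j \<le> n" "\<And>i. \<pi> \<in> ?E i \<longleftrightarrow> i \<le> j"
      using overline_mex_conv \<pi> by blast
    \<comment> \<open>Membership in \<open>?E i\<close> means \<open>i \<le> j\<close>, so the terms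
      beyond \<open>j\<close> vanish.\<close>
    have "(\<Sum>i=1..n. (-1) ^ i * (if \<pi> \<in> ?E i then 1 else 0 :: real)) = (\<Sum>i=1..j. (-1) ^ i)"
      unfolding j(3) using j(2) by (intro sum.mono_neutral_cong_right) auto
    also have "\<dots> = (if odd j then -1 else 0)"
      by (rule alternating_sum_atMost)
    finally have "- (\<Sum>i=1..n. (-1) ^ i * (if \<pi> \<in> ?E i then 1 else 0 :: real)) =
        (if odd j then 1 else 0)"
      by simp
    moreover have "\<pi> \<in> ?M \<longleftrightarrow> odd j"
    proof -
      have "2 * j + 1 \<ge> 2 * 1 + 1 \<and> (2 * j + 1) mod 4 = (2 * 1 + 1) mod 4 \<longleftrightarrow> odd j"
        by presburger
      then show ?thesis
        using \<pi> by (simp add: j(1) cong_def)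
    qed
    ultimately show ?thesis by simp
  qed
  have "real (op_2_1 n 1) = (\<Sum>\<pi>\<in>?O. if \<pi> \<in> ?M then 1 else 0)"
  proof -
    have "real (card ?M) = (\<Sum>\<pi>\<in>?M. 1)"
      by simp
    also have "\<dots> = (\<Sum>\<pi>\<in>?O. if \<pi> \<in> ?M then 1 else 0)"
      using finite_overpartitions by (intro sum.mono_neutral_cong_left) auto
    finally show ?thesis
      by (simp add: op_2_1_def)
  qed
  also have "\<dots> = (\<Sum>\<pi>\<in>?O. - (\<Sum>i=1..n. (-1) ^ i * (if \<pi> \<in> ?E i then 1 else 0)))"
    by (intro sum.cong refl indicator)
  also have "\<dots> = - (\<Sum>i=1..n. (-1) ^ i * (\<Sum>\<pi>\<in>?O. if \<pi> \<in> ?E i then 1 else 0))"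
    unfolding sum_negf sum_distrib_left by (subst sum.swap) (rule refl)
  also have "(\<lambda>i. \<Sum>\<pi>\<in>?O. if \<pi> \<in> ?E i then 1 else 0 :: real) = (\<lambda>i. real (card (?E i)))"
  proof
    fix i
    have "(\<Sum>\<pi>\<in>?O. if \<pi> \<in> ?E i then 1 else 0 :: real) = (\<Sum>\<pi>\<in>?E i. 1)"
      using finite_overpartitions
      by (intro sum.mono_neutral_cong_right) (auto simp: overpartitions_containing_def)
    then show "(\<Sum>\<pi>\<in>?O. if \<pi> \<in> ?E i then 1 else 0 :: real) = real (card (?E i))"
      by simp
  qed
  finally show ?thesis .
qed

theorem theorem2p3:
  fixes n :: nat
  assumes "n \<ge> 1"
  shows "real (op_2_1 n 1) = real (overpartition_count n) / 2"
proof -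
  have "real (op_2_1 n 1) =
      - (\<Sum>j=1..n. (-1) ^ j * (if j\<^sup>2 \<le> n then real (overpartition_count (n - j\<^sup>2)) else 0))"
    unfolding op_2_1_eq_alternating_sum card_overpartitions_containing_first_odds
    by (simp add: if_distrib cong: if_cong)
  then show ?thesis
    using gauss_recurrence[OF assms] by simp
qed

end
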